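(* Let $k$ be a fixed positive integer. In the "all violated constraints" model, there is an algorithm which, for an arbitrary hidden $k$SAT instance on $n$ variables and $m$ clauses, either learns the instance (that is, determines for every clause index $j\in[m]$ the set of literals of the clause $C_j$) or else finds a satisfying assignment of the instance, in time $O(mn^k)$, where the constant hidden in the $O$-notation depends only on $k$.
   Context: A SAT formula on Boolean variables $x_1,\dots,x_n$ is a conjunction of clauses $C_1,\dots,C_m$; each clause is a disjunction of literals ($x_i$ or $\overline{x}_i$) on pairwise distinct variables. It is a $k$SAT instance if every clause has at most $k$ literals. Clauses with the same set of literals may occur several times. "All violated constraints" model: the formula is hidden, and the algorithm accesses it only through an oracle. A query is an assignment $\mathbf{x}\in\{0,1\}^n$, and the oracle returns the set of indices $j\in[m]$ of all clauses $C_j$ violated (evaluated to $0$) by $\mathbf{x}$; in particular, if this set is empty then $\mathbf{x}$ is a satisfying assignment. Running time is total running time, with each oracle query costing unit time. *)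

theory Defs
  imports Main
begin

section \<open>SAT formulas\<close>

text \<open>Variables are numbered from 0, so the variables of an instance on \<open>n\<close> variables are
  \<open>0, \<dots>, n - 1\<close>; clause indices of an instance with \<open>m\<close> clauses are \<open>0, \<dots>, m - 1\<close>.
  A formula is a list of clauses, so equal clauses may occur at several indices.\<close>

datatype literal = Pos nat | Neg nat

fun var :: "literal \<Rightarrow> nat" where
  "var (Pos i) = i"
| "var (Neg i) = i"

type_synonym clause = "literal set"
type_synonym formula = "clause list"
type_synonym assignment = "bool list"

fun literal_true :: "assignment \<Rightarrow> literal \<Rightarrow> bool" where
  "literal_true x (Pos i) \<longleftrightarrow> x ! i"
| "literal_true x (Neg i) \<longleftrightarrow> \<not> x ! i"

definition clause_true :: "assignment \<Rightarrow> clause \<Rightarrow> bool" where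
  "clause_true x C \<longleftrightarrow> (\<exists>l\<in>C. literal_true x l)"

definition is_clause :: "nat \<Rightarrow> clause \<Rightarrow> bool" where
  "is_clause n C \<longleftrightarrow> finite C \<and> inj_on var C \<and> var ` C \<subseteq> {..<n}"

definition kSAT_instance :: "nat \<Rightarrow> nat \<Rightarrow> formula \<Rightarrow> bool" where
  "kSAT_instance k n \<phi> \<longleftrightarrow> (\<forall>C\<in>set \<phi>. is_clause n C \<and> card C \<le> k)"

definition satisfies :: "assignment \<Rightarrow> formula \<Rightarrow> bool" where
  "satisfies x \<phi> \<longleftrightarrow> (\<forall>C\<in>set \<phi>. clause_true x C)"

definition violated :: "formula \<Rightarrow> assignment \<Rightarrow> nat set" where
  "violated \<phi> x = {j. j < length \<phi> \<and> \<not> clause_true x (\<phi> ! j)}"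

section \<open>Random access programs with an oracle\<close>

text \<open>The memory is an infinite array of natural numbers. Operands are fixed addresses; only
  \<open>Load\<close>, \<open>Store\<close> and \<open>Query\<close> address memory indirectly. Addition and truncated subtraction are the
  only arithmetic operations, so the unit cost measure is the usual one for random access machines.\<close>

type_synonym memory = "nat \<Rightarrow> nat"

datatype program =
    Skip
  | Const nat nat
  | Copy nat nat
  | Add nat nat nat
  | Sub nat nat nat
  | Load nat nat
  | Store nat nat
  | Query nat nat
  | Seq program program
  | IfNZ nat program program
  | WhileNZ nat program

definition read_assignment :: "nat \<Rightarrow> memory \<Rightarrow> nat \<Rightarrow> assignment" where
  "read_assignment n s b = map (\<lambda>i. s (b + i) \<noteq> 0) [0..<n]"

text \<open>The answer of the oracle is delivered as the characteristic vector of a subset of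
  \<open>{0, \<dots>, m - 1}\<close>, stored in the \<open>m\<close> cells from address \<open>b\<close> on.\<close>

definition write_answer :: "nat \<Rightarrow> memory \<Rightarrow> nat \<Rightarrow> nat set \<Rightarrow> memory" where
  "write_answer m s b V =
     (\<lambda>a. if b \<le> a \<and> a < b + m then (if a - b \<in> V then 1 else 0) else s a)"

text \<open>\<open>exec n m orc c s t s'\<close>: started in memory \<open>s\<close>, the program \<open>c\<close> terminates after exactly \<open>t\<close>
  time units in memory \<open>s'\<close>. Every elementary instruction, every query and every test of a branch
  or loop costs one unit. The program can access \<open>orc\<close> only through \<open>Query\<close>.\<close>

inductive exec ::
  "nat \<Rightarrow> nat \<Rightarrow> (assignment \<Rightarrow> nat set) \<Rightarrow> program \<Rightarrow> memory \<Rightarrow> nat \<Rightarrow> memory \<Rightarrow> bool"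
  for n m :: nat and orc :: "assignment \<Rightarrow> nat set"
where
  Skip: "exec n m orc Skip s 1 s"
| Const: "exec n m orc (Const a c) s 1 (s(a := c))"
| Copy: "exec n m orc (Copy a b) s 1 (s(a := s b))"
| Add: "exec n m orc (Add a b c) s 1 (s(a := s b + s c))"
| Sub: "exec n m orc (Sub a b c) s 1 (s(a := s b - s c))"
| Load: "exec n m orc (Load a b) s 1 (s(a := s (s b)))"
| Store: "exec n m orc (Store a b) s 1 (s(s a := s b))"
| Query: "exec n m orc (Query a b) s 1
            (write_answer m s (s b) (orc (read_assignment n s (s a))))"
| Seq: "exec n m orc c1 s t1 s' \<Longrightarrow> exec n m orc c2 s' t2 s'' \<Longrightarrow>
          exec n m orc (Seq c1 c2) s (t1 + t2) s''"
| IfTrue: "s a \<noteq> 0 \<Longrightarrow> exec n m orc c1 s t s' \<Longrightarrow> exec n m orc (IfNZ a c1 c2) s (t + 1) s'"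
| IfFalse: "s a = 0 \<Longrightarrow> exec n m orc c2 s t s' \<Longrightarrow> exec n m orc (IfNZ a c1 c2) s (t + 1) s'"
| WhileFalse: "s a = 0 \<Longrightarrow> exec n m orc (WhileNZ a c) s 1 s"
| WhileTrue: "s a \<noteq> 0 \<Longrightarrow> exec n m orc c s t1 s' \<Longrightarrow> exec n m orc (WhileNZ a c) s' t2 s'' \<Longrightarrow>
          exec n m orc (WhileNZ a c) s (t1 + t2 + 1) s''"

text \<open>Execution is deterministic, so exhibiting one terminating execution determines the run.\<close>

inductive_cases exec_SeqE: "exec n m orc (Seq c1 c2) s t s'"
inductive_cases exec_IfNZE: "exec n m orc (IfNZ a c1 c2) s t s'"
inductive_cases exec_WhileNZE: "exec n m orc (WhileNZ a c) s t s'"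

lemma exec_deterministic:
  "exec n m orc c s t s' \<Longrightarrow> exec n m orc c s u s'' \<Longrightarrow> u = t \<and> s'' = s'"
proof (induction arbitrary: u s'' rule: exec.induct)
  case (Seq c1 s t1 s' c2 t2 s2)
  from Seq.prems show ?case
    by (rule exec_SeqE) (auto dest!: Seq.IH)
next
  case (IfTrue s a c1 t s' c2)
  from IfTrue.prems show ?case
    by (rule exec_IfNZE) (auto dest: IfTrue.IH simp: IfTrue.hyps(1))
next
  case (IfFalse s a c2 t s' c1)
  from IfFalse.prems show ?case
    by (rule exec_IfNZE) (auto dest: IfFalse.IH simp: IfFalse.hyps(1))
next
  case (WhileFalse s a c)
  from WhileFalse.prems show ?case
    by (rule exec_WhileNZE) (auto simp: WhileFalse.hyps)
next
  case (WhileTrue s a c t1 s' t2 s2)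
  from WhileTrue.prems show ?case
    by (rule exec_WhileNZE) (auto dest!: WhileTrue.IH simp: WhileTrue.hyps(1))
qed (erule exec.cases; simp)+

section \<open>Input and output conventions\<close>

definition initial_memory :: "nat \<Rightarrow> nat \<Rightarrow> memory" where
  "initial_memory n m = (\<lambda>_. 0)(0 := n, 1 := m)"

fun code :: "literal \<Rightarrow> nat" where
  "code (Pos i) = 2 * i + 1"
| "code (Neg i) = 2 * i + 2"

text \<open>On termination cell 0 tells which kind of output is produced and cell 1 contains the address
  at which it starts. If cell 0 is 0, the output is a table with a block of \<open>k\<close> cells for every
  clause index, listing the codes of the literals of that clause; cells with value 0 are unused.
  If cell 0 is 1, the output is an assignment.\<close>

definition outputs_instance :: "nat \<Rightarrow> formula \<Rightarrow> memory \<Rightarrow> bool" where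
  "outputs_instance k \<phi> s \<longleftrightarrow>
     s 0 = 0 \<and> (\<forall>j<length \<phi>. \<phi> ! j = {l. \<exists>p<k. s (s 1 + j * k + p) = code l})"

definition outputs_satisfying_assignment :: "nat \<Rightarrow> formula \<Rightarrow> memory \<Rightarrow> bool" where
  "outputs_satisfying_assignment n \<phi> s \<longleftrightarrow>
     s 0 = 1 \<and> satisfies (read_assignment n s (s 1)) \<phi>"

end

theory Submission
  imports Defs
begin

text \<open>A clause with at most \<open>k\<close> literals is violated by the assignment that sets exactly the
  variables of its negative literals to 1, so one of the \<open>O(n\<^sup>k)\<close> assignments of weight at
  most \<open>k\<close> violates it. From a violating assignment the clause is learned with \<open>n\<close> further
  queries: flipping one variable makes the clause true iff that variable occurs in it, and the
  sign of the literal is determined by the value of the variable. Hence every clause is learned in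
  time \<open>O(n\<^sup>k)\<close>, reading one bit of each answer, and satisfying assignments need no attention.\<close>

section \<open>Weakest preconditions with running time\<close>

text \<open>The postcondition also receives the running time, so correctness and cost are proved
  together. Execution is deterministic, hence the existential quantifier speaks of the only
  run.\<close>

definition wp ::
  "nat \<Rightarrow> nat \<Rightarrow> (assignment \<Rightarrow> nat set) \<Rightarrow> program \<Rightarrow> memory \<Rightarrow> (nat \<Rightarrow> memory \<Rightarrow> bool) \<Rightarrow> bool"
where
  "wp n m orc c s Q \<longleftrightarrow> (\<exists>t s'. exec n m orc c s t s' \<and> Q t s')"

lemma exec_iff:
  "exec n m orc Skip s t s' \<longleftrightarrow> t = 1 \<and> s' = s"
  "exec n m orc (Const a v) s t s' \<longleftrightarrow> t = 1 \<and> s' = s(a := v)"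
  "exec n m orc (Copy a b) s t s' \<longleftrightarrow> t = 1 \<and> s' = s(a := s b)"
  "exec n m orc (Add a b c) s t s' \<longleftrightarrow> t = 1 \<and> s' = s(a := s b + s c)"
  "exec n m orc (Sub a b c) s t s' \<longleftrightarrow> t = 1 \<and> s' = s(a := s b - s c)"
  "exec n m orc (Load a b) s t s' \<longleftrightarrow> t = 1 \<and> s' = s(a := s (s b))"
  "exec n m orc (Store a b) s t s' \<longleftrightarrow> t = 1 \<and> s' = s(s a := s b)"
  "exec n m orc (Query a b) s t s' \<longleftrightarrow>
     t = 1 \<and> s' = write_answer m s (s b) (orc (read_assignment n s (s a)))"
  by (auto elim: exec.cases intro: exec.intros[unfolded One_nat_def])

lemma wp_simps [simp]:
  "wp n m orc Skip s Q \<longleftrightarrow> Q 1 s"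
  "wp n m orc (Const a v) s Q \<longleftrightarrow> Q 1 (s(a := v))"
  "wp n m orc (Copy a b) s Q \<longleftrightarrow> Q 1 (s(a := s b))"
  "wp n m orc (Add a b c) s Q \<longleftrightarrow> Q 1 (s(a := s b + s c))"
  "wp n m orc (Sub a b c) s Q \<longleftrightarrow> Q 1 (s(a := s b - s c))"
  "wp n m orc (Load a b) s Q \<longleftrightarrow> Q 1 (s(a := s (s b)))"
  "wp n m orc (Store a b) s Q \<longleftrightarrow> Q 1 (s(s a := s b))"
  "wp n m orc (Query a b) s Q \<longleftrightarrow>
     Q 1 (write_answer m s (s b) (orc (read_assignment n s (s a))))"
  by (auto simp: wp_def exec_iff)

lemma wp_Seq [simp]:
  "wp n m orc (Seq c1 c2) s Q \<longleftrightarrow>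
     wp n m orc c1 s (\<lambda>t1 s1. wp n m orc c2 s1 (\<lambda>t2. Q (t1 + t2)))"
  unfolding wp_def by (blast intro: exec.Seq elim: exec_SeqE)

lemma wp_IfNZ [simp]:
  "wp n m orc (IfNZ a c1 c2) s Q \<longleftrightarrow>
     (if s a \<noteq> 0 then wp n m orc c1 s (\<lambda>t. Q (t + 1)) else wp n m orc c2 s (\<lambda>t. Q (t + 1)))"
  unfolding wp_def by (auto intro: exec.IfTrue[unfolded Suc_eq_plus1[symmetric]]
      exec.IfFalse[unfolded Suc_eq_plus1[symmetric]] elim!: exec_IfNZE)

lemma wp_mono:
  assumes "wp n m orc c s P" and "\<And>t s'. P t s' \<Longrightarrow> Q t s'"
  shows "wp n m orc c s Q"
  using assms unfolding wp_def by blast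

text \<open>\<open>R\<close> forgets the exact time of the first program, so the bounds add and the
  second program is analysed only once.\<close>

lemma wp_Seq_bounded:
  assumes "wp n m orc c1 s (\<lambda>t s'. t \<le> T1 \<and> R s')"
    and "\<And>s'. R s' \<Longrightarrow> wp n m orc c2 s' (\<lambda>t s''. t \<le> T2 \<and> Q s'')"
  shows "wp n m orc (Seq c1 c2) s (\<lambda>t s''. t \<le> T1 + T2 \<and> Q s'')"
  unfolding wp_Seq
proof (rule wp_mono[OF assms(1)])
  fix t s'
  assume "t \<le> T1 \<and> R s'"
  then show "wp n m orc c2 s' (\<lambda>t2 s''. t + t2 \<le> T1 + T2 \<and> Q s'')"
    by (intro wp_mono[OF assms(2)]) auto
qed

text \<open>Register \<open>a\<close> is itself the variant, so its initial value bounds the number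
  of rounds. Each round costs at most \<open>T\<close> plus one test, and the final test costs one
  more.\<close>

lemma wp_WhileNZ:
  assumes step: "\<And>s. I s \<Longrightarrow> s a \<noteq> 0 \<Longrightarrow> wp n m orc c s (\<lambda>t s'. t \<le> T \<and> I s' \<and> s' a < s a)"
    and "I s"
  shows "wp n m orc (WhileNZ a c) s (\<lambda>t s'. t \<le> s a * (T + 1) + 1 \<and> I s' \<and> s' a = 0)"
  using \<open>I s\<close>
proof (induction "s a" arbitrary: s rule: less_induct)
  case less
  show ?case
  proof (cases "s a = 0")
    case True
    then show ?thesis
      unfolding wp_def using less.prems by (auto intro!: exI exec.WhileFalse[unfolded One_nat_def])
  next
    case False
    then obtain t1 s1 where 1: "exec n m orc c s t1 s1" "t1 \<le> T" "I s1" "s1 a < s a"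
      using step[OF less.prems] unfolding wp_def by blast
    then obtain t2 s2 where 2: "exec n m orc (WhileNZ a c) s1 t2 s2"
        "t2 \<le> s1 a * (T + 1) + 1" "I s2" "s2 a = 0"
      using less.hyps unfolding wp_def by blast
    have "(s1 a + 1) * (T + 1) \<le> s a * (T + 1)"
      using 1(4) by (intro mult_right_mono) auto
    then have "t1 + t2 + 1 \<le> s a * (T + 1) + 1"
      using 1(2) 2(2) by (simp add: algebra_simps)
    then show ?thesis
      unfolding wp_def using exec.WhileTrue[OF False 1(1) 2(1)] 2(3,4) by blast
  qed
qed

section \<open>Clauses and assignments\<close>

definition assignment_of :: "nat \<Rightarrow> nat set \<Rightarrow> assignment" where
  "assignment_of n S = map (\<lambda>i. i \<in> S) [0..<n]"

text \<open>The only literal on variable \<open>i\<close> that is false when exactly the variables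
  in \<open>S\<close> are true.\<close>

definition false_literal :: "nat set \<Rightarrow> nat \<Rightarrow> literal" where
  "false_literal S i = (if i \<in> S then Neg i else Pos i)"

lemma var_false_literal [simp]: "var (false_literal S i) = i"
  by (simp add: false_literal_def)

lemma code_inject [simp]: "code l = code l' \<longleftrightarrow> l = l'"
  by (cases l; cases l'; simp; presburger)

lemma code_pos [simp]: "0 < code l"
  by (cases l) simp_all

lemma literal_true_assignment_of:
  "var l < n \<Longrightarrow> literal_true (assignment_of n S) l \<longleftrightarrow> l \<noteq> false_literal S (var l)"
  by (cases l) (auto simp: assignment_of_def false_literal_def)

lemma clause_true_assignment_of:
  assumes "var ` C \<subseteq> {..<n}"
  shows "clause_true (assignment_of n S) C \<longleftrightarrow> (\<exists>l\<in>C. l \<noteq> false_literal S (var l))"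
  unfolding clause_true_def using assms
  by (intro bex_cong refl literal_true_assignment_of) auto

text \<open>Negative literals are false because their variables are set. A positive literal
  \<open>Pos i\<close> is false because injectivity of \<open>var\<close> keeps \<open>Neg i\<close>
  out of the clause.\<close>

lemma violated_by_negated_variables:
  assumes "is_clause n C"
  shows "\<not> clause_true (assignment_of n {i. Neg i \<in> C}) C"
proof -
  have "l = false_literal {i. Neg i \<in> C} (var l)" if "l \<in> C" for l
    using that assms inj_onD[of var C "Pos (var l)" "Neg (var l)"]
    by (cases l) (auto simp: is_clause_def false_literal_def)
  then show ?thesis
    using assms clause_true_assignment_of[of C n] unfolding is_clause_def by blast
qed

lemma negated_variables_bounded:
  assumes "is_clause n C"
  shows "{i. Neg i \<in> C} \<subseteq> {..<n}" and "card {i. Neg i \<in> C} \<le> card C"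
proof -
  have sub: "{i. Neg i \<in> C} \<subseteq> var ` C"
    by force
  then show "{i. Neg i \<in> C} \<subseteq> {..<n}"
    using assms unfolding is_clause_def by blast
  have "card {i. Neg i \<in> C} \<le> card (var ` C)"
    using assms sub by (intro card_mono) (auto simp: is_clause_def)
  also have "\<dots> \<le> card C"
    using assms by (intro card_image_le) (auto simp: is_clause_def)
  finally show "card {i. Neg i \<in> C} \<le> card C" .
qed

text \<open>Every literal of a falsified clause is the false literal of its variable, and flipping
  \<open>i\<close> changes the truth value of literals on \<open>i\<close> only.\<close>

lemma clause_true_flip:
  assumes "var ` C \<subseteq> {..<n}" and "\<not> clause_true (assignment_of n S) C"
  shows "clause_true (assignment_of n {i'. (i' \<in> S) \<noteq> (i' = i)}) C \<longleftrightarrow> false_literal S i \<in> C"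
    (is "clause_true (assignment_of n ?S) C \<longleftrightarrow> _")
proof -
  have *: "l = false_literal S (var l)" if "l \<in> C" for l
    using that assms clause_true_assignment_of[of C n] by blast
  have "l \<noteq> false_literal ?S (var l) \<longleftrightarrow> l = false_literal S i" if "l \<in> C" for l
    using *[OF that] by (cases l) (auto simp: false_literal_def split: if_splits)
  then show ?thesis
    using assms(1) clause_true_assignment_of[of C n ?S] by blast
qed

section \<open>The program\<close>

fun block :: "program list \<Rightarrow> program" where
  "block [] = Skip"
| "block (c # cs) = Seq c (block cs)"

text \<open>Register allocation: 2 and 3 hold the constants 1 and 0; 4 and 5 the addresses of the
  query and of the answer; 6 and 7 the numbers \<open>n + 1\<close> and \<open>k\<close>; 8 the number of clauses left;
  9 the address of the answer bit of the current clause; 10 and 11 the output block of the current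
  clause and the next free cell of it; 12 a variable; 13 to 17 are scratch; 18 is nonzero
  as long as no violating assignment for the current clause is known; 20 to \<open>19 + k\<close> are the loop
  counters of the search.

  The query occupies \<open>n + 1\<close> cells. The last one is invisible to the oracle; selecting it amounts
  to selecting no variable. The cells count how often a variable is selected, so that
  deselecting it on one level of the search respects selections on the other levels.\<close>

fun search :: "nat \<Rightarrow> program" where
  "search 0 = block [Query 4 5, Load 14 9, IfNZ 14 (Const 18 0) Skip]"
| "search (Suc d) = block [Copy (20 + d) 6,
     WhileNZ (20 + d) (block [Sub (20 + d) (20 + d) 2,
       IfNZ 18 (block [Add 13 4 (20 + d), Load 14 13, Add 14 14 2, Store 13 14,
         search d,
         IfNZ 18 (block [Add 13 4 (20 + d), Load 14 13, Sub 14 14 2, Store 13 14]) Skip]) Skip])]"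

text \<open>A successful search leaves its selection in the query, so it is erased before the next
  clause is treated. Counting down from \<open>n + 1\<close> also clears the extra cell.\<close>

definition clear :: program where
  "clear = block [Copy 12 6, WhileNZ 12 (block [Sub 12 12 2, Add 13 4 12, Store 13 3])]"

text \<open>Truncated subtraction makes \<open>1 - v\<close> the negation of a cell even if its
  count \<open>v\<close> exceeds 1. Subtracting the same value from \<open>2 * i + 2\<close> yields
  the code of the false literal, and the last \<open>Store\<close> restores the count.\<close>

definition probe :: program where
  "probe = block [Sub 12 12 2, Add 13 4 12, Load 14 13, Sub 15 2 14, Store 13 15,
     Query 4 5, Load 16 9,
     IfNZ 16 Skip (block [Add 17 12 12, Add 17 17 2, Add 17 17 2, Sub 17 17 15,
       Store 11 17, Add 11 11 2]),
     Store 13 14]"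

definition probe_all :: program where
  "probe_all = block [Copy 11 10, Copy 12 0, WhileNZ 12 probe]"

definition learn_clause :: "nat \<Rightarrow> program" where
  "learn_clause k = block [clear, Const 18 1, search k, probe_all,
     Add 9 9 2, Add 10 10 7, Sub 8 8 2]"

definition learn :: "nat \<Rightarrow> program" where
  "learn k = block [Const 2 1, Const 4 (20 + k), Add 6 0 2, Add 5 4 6, Const 7 k, Copy 8 1,
     Copy 9 5, Add 10 5 1, WhileNZ 8 (learn_clause k), Const 0 0, Add 1 5 1]"

fun search_const :: "nat \<Rightarrow> nat" where
  "search_const 0 = 10"
| "search_const (Suc d) = search_const d + 30"

section \<open>Correctness\<close>

locale hidden_instance =
  fixes k n m :: nat and \<phi> :: formula
  assumes k_pos: "k \<ge> 1" and inst: "kSAT_instance k n \<phi>" and len: "length \<phi> = m"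
begin

abbreviation wpr :: "program \<Rightarrow> memory \<Rightarrow> (nat \<Rightarrow> memory \<Rightarrow> bool) \<Rightarrow> bool" where
  "wpr \<equiv> wp n m (violated \<phi>)"

definition static :: "memory \<Rightarrow> bool" where
  "static s \<longleftrightarrow> s 0 = n \<and> s 1 = m \<and> s 2 = 1 \<and> s 3 = 0 \<and> s 4 = 20 + k \<and> s 5 = 21 + k + n \<and>
     s 6 = n + 1 \<and> s 7 = k"

definition selected :: "memory \<Rightarrow> nat set" where
  "selected s = {i. i < n \<and> s (20 + k + i) \<noteq> 0}"

definition falsifies :: "nat set \<Rightarrow> nat \<Rightarrow> bool" where
  "falsifies S j \<longleftrightarrow> \<not> clause_true (assignment_of n S) (\<phi> ! j)"

lemma static_cong: "static s \<Longrightarrow> (\<And>a. a < 8 \<Longrightarrow> s' a = s a) \<Longrightarrow> static s'"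
  by (simp add: static_def)

lemma read_selected: "read_assignment n s (20 + k) = assignment_of n (selected s)"
  by (auto simp: read_assignment_def assignment_of_def selected_def)

text \<open>Only membership below \<open>n\<close> matters, which makes the extra index
  \<open>n\<close> harmless.\<close>

lemma falsifies_cong: "(\<And>i. i < n \<Longrightarrow> i \<in> S \<longleftrightarrow> i \<in> S') \<Longrightarrow> falsifies S j = falsifies S' j"
proof -
  assume "\<And>i. i < n \<Longrightarrow> i \<in> S \<longleftrightarrow> i \<in> S'"
  then have "assignment_of n S = assignment_of n S'"
    by (auto simp: assignment_of_def)
  then show ?thesis
    by (simp add: falsifies_def)
qed

lemma in_violated_iff: "j < m \<Longrightarrow> j \<in> violated \<phi> (assignment_of n S) \<longleftrightarrow> falsifies S j"
  by (simp add: violated_def falsifies_def len)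

section \<open>Search for a violating assignment of bounded weight\<close>

definition search_frame :: "nat \<Rightarrow> memory \<Rightarrow> memory \<Rightarrow> bool" where
  "search_frame d s s' \<longleftrightarrow> (\<forall>a. a \<notin> {13, 14, 18} \<union> {20..<20 + d} \<union> {20 + k..<21 + k + n + m}
     \<longrightarrow> s' a = s a)"

text \<open>On success the violating query is left in place. On failure the counts are restored
  exactly, including that of the extra cell, so that the enclosing level can undo its own
  selection.\<close>

definition search_result :: "nat \<Rightarrow> nat set set \<Rightarrow> memory \<Rightarrow> memory \<Rightarrow> bool" where
  "search_result j F s s' \<longleftrightarrow>
     (s' 18 = 0 \<longrightarrow> falsifies (selected s') j) \<and>
     (s' 18 \<noteq> 0 \<longrightarrow> (\<forall>i\<le>n. s' (20 + k + i) = s (20 + k + i)) \<and>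
        (\<forall>T\<in>F. \<not> falsifies (selected s \<union> T) j))"

definition small_sets :: "nat \<Rightarrow> nat set set" where
  "small_sets d = {T. T \<subseteq> {..<n} \<and> card T \<le> d}"

text \<open>A nonempty set splits off any of its elements. The empty set is represented by the extra
  index \<open>n\<close>, which is invisible below \<open>n\<close>; thus a search of fixed depth
  also reaches smaller sets.\<close>

lemma small_sets_Suc:
  assumes "T \<in> small_sets (Suc d)"
  obtains i T' where "i \<le> n" "T' \<in> small_sets d" "\<And>i'. i' < n \<Longrightarrow> i' \<in> T \<longleftrightarrow> i' \<in> insert i T'"
proof (cases "T = {}")
  case True
  show ?thesis
    by (rule that[of n "{}"]) (auto simp: True small_sets_def)
next
  case False
  then obtain i where i: "i \<in> T" by blast
  have "finite T" using assms finite_subset by (auto simp: small_sets_def)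
  show ?thesis
    by (rule that[of i "T - {i}"]) (use assms i \<open>finite T\<close> in \<open>auto simp: small_sets_def\<close>)
qed


text \<open>Induction on the depth: each level chooses one of \<open>n + 1\<close> indices and
  leaves the rest to the level below, whence the power of \<open>n + 1\<close>. Sets are tried on
  top of the selection present on entry, and the frame protects the loop counters of outer
  levels.\<close>

lemma wp_search:
  assumes "d \<le> k" "static s" "j < m" "s 9 = 21 + k + n + j" "s 18 \<noteq> 0"
  shows "wpr (search d) s (\<lambda>t s'. t \<le> search_const d * (n + 1) ^ d \<and> search_frame d s s' \<and>
    search_result j (small_sets d) s s')"
  using assms
proof (induction d arbitrary: s)
  case 0
  have "finite T \<Longrightarrow> T = {}" if "card T = 0" for T :: "nat set"
    using that by simp
  then have small: "small_sets 0 = {{}}"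
    by (auto simp: small_sets_def finite_subset[of _ "{..<n}"])
  define V where "V = violated \<phi> (assignment_of n (selected s))"
  have V: "j \<in> V \<longleftrightarrow> falsifies (selected s) j"
    using 0 by (simp add: V_def in_violated_iff)
  define s1 where "s1 = write_answer m s (21 + k + n) V"
  have s1: "s1 9 = 21 + k + n + j" "s1 18 \<noteq> 0" "s1 (21 + k + n + j) = (if j \<in> V then 1 else 0)"
    using 0 by (auto simp: s1_def write_answer_def)
  have sel: "selected (s1(14 := x, 18 := y)) = selected s"
       "selected (s1(14 := x)) = selected s" for x y
    by (auto simp: selected_def s1_def write_answer_def)
  have q: "write_answer m s (s 5) (violated \<phi> (read_assignment n s (s 4))) = s1"
    using 0 by (simp add: static_def s1_def V_def read_selected)
  have fr: "\<forall>a. a \<notin> {20 + k..<21 + k + n + m} \<longrightarrow> s1 a = s a"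
     "\<forall>i\<le>n. s1 (20 + k + i) = s (20 + k + i)"
    by (auto simp: s1_def write_answer_def)
  show ?case
    using s1 V fr
    by (auto simp: q sel small search_frame_def search_result_def)
next
  case (Suc d)
  then have dk: "d < k"
    by simp
  \<comment> \<open>The counter runs downwards, so as long as nothing has been found, the indices
    from its value up to \<open>n\<close> have been tried.\<close>
  define I where "I s' \<longleftrightarrow> search_frame (Suc d) s s' \<and> s' (20 + d) \<le> n + 1 \<and>
     (s' 18 = 0 \<longrightarrow> falsifies (selected s') j) \<and>
     (s' 18 \<noteq> 0 \<longrightarrow> (\<forall>i\<le>n. s' (20 + k + i) = s (20 + k + i)) \<and>
       (\<forall>i. s' (20 + d) \<le> i \<and> i \<le> n \<longrightarrow>
          (\<forall>T\<in>small_sets d. \<not> falsifies (selected s \<union> insert i T) j)))" for s'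
  \<comment> \<open>\<open>14\<close> counts the instructions and tests of the loop body other than
    the recursive search.\<close>
  define T where "T = search_const d * (n + 1) ^ d + 14"
  define body where "body = block [Sub (20 + d) (20 + d) 2,
       IfNZ 18 (block [Add 13 4 (20 + d), Load 14 13, Add 14 14 2, Store 13 14,
         search d,
         IfNZ 18 (block [Add 13 4 (20 + d), Load 14 13, Sub 14 14 2, Store 13 14]) Skip]) Skip]"
  have step: "wpr body s' (\<lambda>t s''. t \<le> T \<and> I s'' \<and> s'' (20 + d) < s' (20 + d))"
    if I: "I s'" and nz: "s' (20 + d) \<noteq> 0" for s'
  proof -
    have fr: "s' a = s a" if "a \<notin> {13, 14, 18} \<union> {20..<20 + Suc d} \<union> {20 + k..<21 + k + n + m}" for a
      using I that by (auto simp: I_def search_frame_def)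
    have st: "static s'"
      by (rule static_cong[OF Suc.prems(2)]) (simp add: fr)
    then have st2: "s' 2 = 1" "s' 4 = 20 + k"
      by (simp_all add: static_def)
    obtain r where r: "s' (20 + d) = Suc r"
      using nz not0_implies_Suc by blast
    have rn: "r \<le> n"
      using I r by (simp add: I_def)
    show ?thesis
    proof (cases "s' 18 = 0")
      case True
      \<comment> \<open>After success the remaining rounds only decrement the counter, which lies
        outside the query.\<close>
      have "selected (s'(20 + d := r)) = selected s'"
        using Suc.prems(1) by (auto simp: selected_def)
      then have "I (s'(20 + d := r))"
        using I True r by (auto simp: I_def search_frame_def)
      then show ?thesis
        using True r st2 by (simp add: body_def T_def)
    next
      case False
      define s1 where "s1 = s'(20 + d := r, 13 := 20 + k + r, 14 := Suc (s' (20 + k + r)),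
          20 + k + r := Suc (s' (20 + k + r)))"
      have X: "\<forall>i\<le>n. s' (20 + k + i) = s (20 + k + i)"
        and tried: "\<And>i T. s' (20 + d) \<le> i \<Longrightarrow> i \<le> n \<Longrightarrow> T \<in> small_sets d \<Longrightarrow>
           \<not> falsifies (selected s \<union> insert i T) j"
        using I False by (auto simp: I_def)
      have st1: "static s1"
        by (rule static_cong[OF st]) (simp add: s1_def)
      have s1: "s1 9 = 21 + k + n + j" "s1 18 \<noteq> 0"
        using False Suc.prems(4) fr[of 9] by (simp_all add: s1_def)
      have X1: "s1 (20 + k + i) = (if i = r then Suc (s (20 + k + i)) else s (20 + k + i))"
        if "i \<le> n" for i
        using that X Suc.prems(1) by (simp add: s1_def)
      have sel1: "i \<in> selected s1 \<longleftrightarrow> i \<in> insert r (selected s)" if "i < n" for i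
        using that X1[of i] by (simp add: selected_def)
      have IH: "wpr (search d) s1 (\<lambda>t s'. t \<le> search_const d * (n + 1) ^ d \<and>
          search_frame d s1 s' \<and> search_result j (small_sets d) s1 s')"
        using Suc.prems s1 st1 by (intro Suc.IH) auto
      \<comment> \<open>This prepares the code after the recursive search for either outcome: on
        success the invariant holds at once, on failure after the selected cell is
        decremented.\<close>
      have fin: "s2 2 = 1 \<and> s2 4 = 20 + k \<and> s2 (20 + d) = r \<and> t + 14 \<le> T \<and>
          (s2 18 = 0 \<longrightarrow> I s2) \<and>
          (s2 18 \<noteq> 0 \<longrightarrow> I (s2(13 := 20 + k + r, 14 := s2 (20 + k + r) - 1,
             20 + k + r := s2 (20 + k + r) - 1)))"
        if t: "t \<le> search_const d * (n + 1) ^ d" and frame: "search_frame d s1 s2"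
          and result: "search_result j (small_sets d) s1 s2" for t s2
      proof -
        have fr2: "s2 a = s1 a" if "a \<notin> {13, 14, 18} \<union> {20..<20 + d} \<union> {20 + k..<21 + k + n + m}" for a
          using frame that by (auto simp: search_frame_def)
        have s2: "s2 2 = 1" "s2 4 = 20 + k" "s2 (20 + d) = r"
          using st2 dk by (simp_all add: fr2 s1_def)
        have fr3: "s2 a = s a"
          if "a \<notin> {13, 14, 18} \<union> {20..<20 + Suc d} \<union> {20 + k..<21 + k + n + m}" for a
          using that rn dk by (subst fr2) (auto simp: s1_def fr)
        have "I s2" if "s2 18 = 0"
          using that result fr3 s2 rn by (auto simp: I_def search_frame_def search_result_def)
        moreover have "I s3"
          if nz2: "s2 18 \<noteq> 0" and s3: "s3 = s2(13 := 20 + k + r, 14 := s2 (20 + k + r) - 1,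
             20 + k + r := s2 (20 + k + r) - 1)" for s3
        proof -
          have X2: "s2 (20 + k + i) = s1 (20 + k + i)" if "i \<le> n" for i
            using result nz2 that by (simp add: search_result_def)
          \<comment> \<open>Decrementing undoes exactly the increment made before the recursive
            call, also for a variable already selected by an outer level.\<close>
          have "s3 (20 + k + i) = s (20 + k + i)" if "i \<le> n" for i
            using X1[OF that] X2[OF that] rn by (auto simp: s3)
          moreover have "\<not> falsifies (selected s \<union> insert i T) j"
            if "r \<le> i" "i \<le> n" "T \<in> small_sets d" for i T
          proof (cases "i = r")
            case True
            have "\<not> falsifies (selected s1 \<union> T) j"
              using result nz2 that by (simp add: search_result_def)
            moreover have "falsifies (selected s1 \<union> T) j = falsifies (selected s \<union> insert i T) j"
              by (rule falsifies_cong) (auto simp: sel1 True)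
            ultimately show ?thesis
              by simp
          next
            case False
            then show ?thesis
              using tried that r by simp
          qed
          moreover have "search_frame (Suc d) s s3"
            using fr3 rn by (auto simp: s3 search_frame_def)
          moreover have "s3 (20 + d) = r" "s3 18 \<noteq> 0"
            using s2 nz2 dk by (simp_all add: s3)
          ultimately show ?thesis
            using rn by (simp add: I_def)
        qed
        ultimately show ?thesis
          using t s2 by (simp add: T_def)
      qed
      have "wpr (search d) s1 (\<lambda>t s2. s2 2 = 1 \<and> s2 4 = 20 + k \<and> s2 (20 + d) = r \<and> t + 14 \<le> T \<and>
          (s2 18 = 0 \<longrightarrow> I s2) \<and>
          (s2 18 \<noteq> 0 \<longrightarrow> I (s2(13 := 20 + k + r, 14 := s2 (20 + k + r) - 1,
             20 + k + r := s2 (20 + k + r) - 1))))"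
        by (rule wp_mono[OF IH]) (use fin in blast)
      then show ?thesis
        using False r st2 dk unfolding s1_def
        by (simp add: body_def) (erule wp_mono, auto)
    qed
  qed
  have "wpr (WhileNZ (20 + d) body) (s(20 + d := n + 1))
     (\<lambda>t s'. t \<le> (s(20 + d := n + 1)) (20 + d) * (T + 1) + 1 \<and> I s' \<and> s' (20 + d) = 0)"
    using step
  proof (rule wp_WhileNZ)
    show "I (s(20 + d := n + 1))"
      using Suc.prems dk by (auto simp: I_def search_frame_def)
  qed
  then have "wpr (WhileNZ (20 + d) body) (s(20 + d := n + 1))
     (\<lambda>t s'. t + 2 \<le> search_const (Suc d) * (n + 1) ^ Suc d \<and> search_frame (Suc d) s s' \<and>
        search_result j (small_sets (Suc d)) s s')"
  proof (rule wp_mono)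
    fix t s'
    assume *: "t \<le> (s(20 + d := n + 1)) (20 + d) * (T + 1) + 1 \<and> I s' \<and> s' (20 + d) = 0"
    define N where "N = (n + 1) ^ d"
    have "1 \<le> N"
      by (simp add: N_def)
    \<comment> \<open>The \<open>15\<close> is the overhead of the body plus the loop test; the
      \<open>3\<close> is the final test, the initialisation of the counter and the closing
      \<open>Skip\<close>.\<close>
    then have "t + 2 \<le> (n + 1) * (search_const d * N + 15 * N) + 3 * ((n + 1) * N)"
      using * mult_le_mono2[of "search_const d * N + 15" "search_const d * N + 15 * N" "n + 1"]
        mult_le_mono[of 1 "n + 1" 1 N]
      by (simp add: T_def N_def algebra_simps)
    also have "\<dots> \<le> search_const (Suc d) * (n + 1) ^ Suc d"
      by (simp add: N_def algebra_simps)
    finally have "t + 2 \<le> search_const (Suc d) * (n + 1) ^ Suc d" .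
    moreover have "\<not> falsifies (selected s \<union> S) j"
      if nz: "s' 18 \<noteq> 0" and S: "S \<in> small_sets (Suc d)" for S
    proof -
      obtain i S' where S': "i \<le> n" "S' \<in> small_sets d"
        "\<And>i'. i' < n \<Longrightarrow> i' \<in> S \<longleftrightarrow> i' \<in> insert i S'"
        using small_sets_Suc[OF S] by blast
      have "falsifies (selected s \<union> S) j = falsifies (selected s \<union> insert i S') j"
        using S'(3) by (intro falsifies_cong) auto
      then show ?thesis
        using S' * nz by (auto simp: I_def)
    qed
    ultimately show "t + 2 \<le> search_const (Suc d) * (n + 1) ^ Suc d \<and> search_frame (Suc d) s s' \<and>
        search_result j (small_sets (Suc d)) s s'"
      using * by (auto simp: I_def search_result_def)
  qed
  then show ?case
    using Suc.prems(2) unfolding search.simps body_def[symmetric]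
    by (simp add: static_def del: search_const.simps)
qed

section \<open>Clearing the query and probing its variables\<close>

lemma wp_clear:
  assumes "static s"
  shows "wpr clear s (\<lambda>t s'. t \<le> 10 * (n + 1) \<and>
     (\<forall>a. a \<notin> {12, 13} \<union> {20 + k..<21 + k + n} \<longrightarrow> s' a = s a) \<and> selected s' = {})"
proof -
  define body where "body = block [Sub 12 12 2, Add 13 4 12, Store 13 3]"
  define I where "I s' \<longleftrightarrow> (\<forall>a. a \<notin> {12, 13} \<union> {20 + k..<21 + k + n} \<longrightarrow> s' a = s a) \<and>
     s' 12 \<le> n + 1 \<and> (\<forall>i. s' 12 \<le> i \<and> i \<le> n \<longrightarrow> s' (20 + k + i) = 0)" for s'
  have step: "wpr body s' (\<lambda>t s''. t \<le> 4 \<and> I s'' \<and> s'' 12 < s' 12)"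
    if I: "I s'" and nz: "s' 12 \<noteq> 0" for s'
  proof -
    obtain r where r: "s' 12 = Suc r"
      using nz not0_implies_Suc by blast
    have "s' 2 = 1" "s' 3 = 0" "s' 4 = 20 + k"
      using I assms by (simp_all add: I_def static_def)
    moreover have "I (s'(12 := r, 13 := 20 + k + r, 20 + k + r := 0))"
      using I r by (auto simp: I_def)
    ultimately show ?thesis
      using r by (simp add: body_def)
  qed
  have "wpr (WhileNZ 12 body) (s(12 := n + 1))
     (\<lambda>t s'. t \<le> (s(12 := n + 1)) 12 * (4 + 1) + 1 \<and> I s' \<and> s' 12 = 0)"
    using step by (rule wp_WhileNZ) (auto simp: I_def)
  then have "wpr (WhileNZ 12 body) (s(12 := n + 1)) (\<lambda>t s'. t + 2 \<le> 10 * (n + 1) \<and>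
     (\<forall>a. a \<notin> {12, 13} \<union> {20 + k..<21 + k + n} \<longrightarrow> s' a = s a) \<and> selected s' = {})"
    by (rule wp_mono) (auto simp: I_def selected_def)
  then show ?thesis
    using assms unfolding clear_def body_def[symmetric] by (simp add: static_def)
qed


lemma wp_probe_all:
  fixes s0 :: memory
  defines "P \<equiv> s0 10" and "S \<equiv> selected s0"
  assumes static: "static s0" and j: "j < m" "s0 9 = 21 + k + n + j" and fals: "falsifies S j"
    and P: "21 + k + n + m \<le> P" and fresh: "\<And>a. P \<le> a \<Longrightarrow> s0 a = 0"
  shows "wpr probe_all s0 (\<lambda>t s. t \<le> 30 * (n + 1) \<and>
     (\<forall>a<P. a \<notin> {11..17} \<union> {20 + k..<21 + k + n + m} \<longrightarrow> s a = s0 a) \<and>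
     (\<forall>a\<ge>P + k. s a = 0) \<and> \<phi> ! j = {l. \<exists>p<k. s (P + p) = code l})"
proof -
  define C where "C = \<phi> ! j"
  have C: "is_clause n C" "card C \<le> k"
    using inst j len nth_mem[of j \<phi>] by (auto simp: kSAT_instance_def C_def)
  then have finC: "finite C" and varC: "var ` C \<subseteq> {..<n}"
    by (simp_all add: is_clause_def)
  have falsC: "\<not> clause_true (assignment_of n S) C"
    using fals by (simp add: falsifies_def C_def)
  \<comment> \<open>The part of the clause that is known once the variables from \<open>i\<close> on
    are probed; its cardinality determines the next free output cell.\<close>
  define D where "D i = {l \<in> C. i \<le> var l}" for i
  have finD: "finite (D i)" for i
    using finC by (simp add: D_def)
  have D_le: "card (D i) \<le> k" for i
    using C(2) card_mono[OF finC, of "D i"] by (force simp: D_def)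
  \<comment> \<open>Being falsified, the clause can contain no literal on \<open>i\<close> other
    than the false one.\<close>
  have D_step: "D i = (if false_literal S i \<in> C then insert (false_literal S i) (D (Suc i)) else D (Suc i))"
    for i
  proof -
    have "l = false_literal S i \<or> Suc i \<le> var l" if "l \<in> C" "i \<le> var l" for l
      using that falsC clause_true_assignment_of[OF varC, of S] by (cases "var l = i") auto
    then show ?thesis
      by (auto simp: D_def Suc_le_eq order.strict_implies_order)
  qed
  have new: "false_literal S i \<notin> D (Suc i)" for i
    by (simp add: D_def)
  define I where "I s \<longleftrightarrow> (\<forall>a<P. a \<notin> {11..17} \<union> {20 + k..<21 + k + n + m} \<longrightarrow> s a = s0 a) \<and>
     (\<forall>i\<le>n. s (20 + k + i) = s0 (20 + k + i)) \<and> s 12 \<le> n \<and> s 11 = P + card (D (s 12)) \<and>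
     {a. s a \<noteq> 0} \<subseteq> {..<s 11} \<and> D (s 12) = {l. \<exists>a\<ge>P. s a = code l}" for s
  have step: "wpr probe s (\<lambda>t s'. t \<le> 20 \<and> I s' \<and> s' 12 < s 12)"
    if I: "I s" and nz: "s 12 \<noteq> 0" for s
  proof -
    obtain i where i: "s 12 = Suc i"
      using nz not0_implies_Suc by blast
    have "i < n"
      using I i by (simp add: I_def)
    have fr: "s a = s0 a" if "a < P" "a \<notin> {11..17} \<union> {20 + k..<21 + k + n + m}" for a
      using I that by (simp add: I_def)
    have cells: "s (20 + k + i') = s0 (20 + k + i')" if "i' \<le> n" for i'
      using I that by (simp add: I_def)
    define q where "q = P + card (D (Suc i))"
    have q: "s 11 = q" "P \<le> q"
      using I i by (simp_all add: I_def q_def)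
    have empty: "{a. s a \<noteq> 0} \<subseteq> {..<q}"
      using I unfolding I_def q(1) by blast
    have table: "D (Suc i) = {l. \<exists>a\<ge>P. s a = code l}"
      using I unfolding I_def i by blast
    have "static s"
      using P by (intro static_cong[OF static] fr) auto
    then have st: "s 2 = 1" "s 4 = 20 + k" "s 5 = 21 + k + n"
      by (simp_all add: static_def)
    have s9: "s 9 = 21 + k + n + j"
      using fr[of 9] P j by simp
    define v where "v = s (20 + k + i)"
    have v: "v \<noteq> 0 \<longleftrightarrow> i \<in> S"
      using I \<open>i < n\<close> by (simp add: I_def v_def S_def selected_def)
    define s1 where "s1 = s(12 := i, 13 := 20 + k + i, 14 := v, 15 := 1 - v, 20 + k + i := 1 - v)"
    have sel: "i' \<in> selected s1 \<longleftrightarrow> (i' \<in> S) \<noteq> (i' = i)" if "i' < n" for i'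
      using that I v by (auto simp: s1_def selected_def I_def S_def)
    define V where "V = violated \<phi> (assignment_of n (selected s1))"
    have "falsifies (selected s1) j = falsifies {i'. (i' \<in> S) \<noteq> (i' = i)} j"
      using sel by (intro falsifies_cong) auto
    then have V: "j \<in> V \<longleftrightarrow> false_literal S i \<notin> C"
      using j clause_true_flip[OF varC falsC, of i]
      by (simp add: V_def in_violated_iff falsifies_def C_def)
    define s2 where "s2 = write_answer m s1 (21 + k + n) V"
    \<comment> \<open>The answer cells stay abstract here, since the program reads only the one for
      clause \<open>j\<close>.\<close>
    have s2: "s2 a = (if 21 + k + n \<le> a \<and> a < 21 + k + n + m then s2 a
       else if a = 12 then i else if a = 13 then 20 + k + i else if a = 14 then v
       else if a = 15 then 1 - v else if a = 20 + k + i then 1 - v else s a)" for a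
      using \<open>i < n\<close> by (auto simp: s2_def s1_def write_answer_def)
    have s2_old: "s2 a = s a"
      if "a \<notin> {12..15} \<union> {21 + k + n..<21 + k + n + m}" "a \<noteq> 20 + k + i" for a
      using that by (subst s2) auto
    have ans: "s2 (21 + k + n + j) = (if j \<in> V then 1 else 0)"
      using j by (simp add: s2_def write_answer_def)
    have cd: "Suc (Suc (i + i)) - (1 - v) = code (false_literal S i)"
      using v by (cases "v = 0") (auto simp: false_literal_def)
    have query: "write_answer m s1 (21 + k + n) (violated \<phi> (read_assignment n s1 (20 + k))) = s2"
      by (simp add: s2_def V_def read_selected)
    have regs: "s2 2 = 1" "s2 9 = 21 + k + n + j" "s2 11 = s 11" "s2 12 = i" "s2 13 = 20 + k + i" "s2 14 = v" "s2 15 = 1 - v"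
      using st s9 by (subst s2; simp)+
    have skip: "I (s2(16 := Suc 0, 20 + k + i := v))" if "j \<in> V"
    proof -
      have "I s'" if s': "s' = s2(16 := Suc 0, 20 + k + i := v)" for s'
      proof -
        \<comment> \<open>The query cell of \<open>i\<close> is covered as well, because its old
          count \<open>v\<close> is written back.\<close>
        have "s' a = s a" if "a \<notin> {11..17} \<union> {21 + k + n..<21 + k + n + m}" for a
          using that by (cases "a = 20 + k + i") (auto simp: s' s2_old v_def)
        moreover have "s' 11 = s 11" "s' 12 = i"
          using regs by (simp_all add: s')
        moreover have "D i = D (Suc i)"
          using V \<open>j \<in> V\<close> D_step[of i] by simp
        moreover have "s' a = s a" if "P \<le> a" for a
          using calculation(1) that P by simp
        ultimately show ?thesis
          unfolding I_def using fr cells q empty table P \<open>i < n\<close>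
          by (intro conjI allI impI) (auto simp: q_def)
      qed
      then show ?thesis
        by simp
    qed
    have found: "I (s2(16 := 0, 17 := code (false_literal S i), q := code (false_literal S i),
       11 := Suc q, 20 + k + i := v))" if "j \<notin> V"
    proof -
      have "I s'" if s': "s' = s2(16 := 0, 17 := code (false_literal S i),
          q := code (false_literal S i), 11 := Suc q, 20 + k + i := v)" for s'
      proof -
        have old: "s' a = s a" if "a \<notin> {11..17} \<union> {21 + k + n..<21 + k + n + m}" "a \<noteq> q" for a
          using that by (cases "a = 20 + k + i") (auto simp: s' s2_old v_def)
        have upd: "s' 11 = Suc q" "s' 12 = i" "s' q = code (false_literal S i)"
          using regs q P \<open>i < n\<close> by (simp_all add: s')
        have D: "D i = insert (false_literal S i) (D (Suc i))" "Suc q = P + card (D i)"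
          using V \<open>j \<notin> V\<close> D_step[of i] finD[of "Suc i"] new[of i] by (simp_all add: q_def)
        have "s' a = s0 a" if "a < P" "a \<notin> {11..17} \<union> {20 + k..<21 + k + n + m}" for a
          using that q old[of a] fr[of a] by auto
        moreover have "s' (20 + k + i') = s0 (20 + k + i')" if "i' \<le> n" for i'
          using that q P old[of "20 + k + i'"] cells[of i'] by simp
        moreover have "a < Suc q" if "s' a \<noteq> 0" for a
        proof (rule ccontr)
          assume "\<not> a < Suc q"
          then have "s' a = s a" "s a = 0"
            using q P old[of a] empty by auto
          with that show False
            by simp
        qed
        moreover have "(\<exists>a\<ge>P. s' a = code l) \<longleftrightarrow> l = false_literal S i \<or> (\<exists>a\<ge>P. s a = code l)" for l
        proof -
          have "s' a = s a" if "P \<le> a" "a \<noteq> q" for a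
            using that P old[of a] by simp
          moreover have "s q = 0"
            using empty by blast
          ultimately show ?thesis
            using upd(3) q(2) code_pos[of l] by (metis code_inject less_irrefl)
        qed
        ultimately show ?thesis
          unfolding I_def upd D(2)[symmetric] using \<open>i < n\<close> D(1) table by auto
      qed
      then show ?thesis
        by simp
    qed
    show ?thesis
      using i st ans skip found regs q P cd
      by (simp add: probe_def query[unfolded s1_def, simplified] flip: v_def)
  qed
  have "wpr (WhileNZ 12 probe) (s0(11 := P, 12 := n))
     (\<lambda>t s. t \<le> (s0(11 := P, 12 := n)) 12 * (20 + 1) + 1 \<and> I s \<and> s 12 = 0)"
    using step
  proof (rule wp_WhileNZ)
    have "D n = {}"
      using varC by (fastforce simp: D_def)
    moreover have "a < P" if "s0 a \<noteq> 0" for a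
      using fresh[of a] that by (meson not_le)
    moreover have "s0 a \<noteq> code l" if "P \<le> a" for a l
      using fresh[OF that] code_pos[of l] by simp
    ultimately show "I (s0(11 := P, 12 := n))"
      using P by (auto simp: I_def)
  qed
  then have "wpr (WhileNZ 12 probe) (s0(11 := P, 12 := n)) (\<lambda>t s. t + 3 \<le> 30 * (n + 1) \<and>
     (\<forall>a<P. a \<notin> {11..17} \<union> {20 + k..<21 + k + n + m} \<longrightarrow> s a = s0 a) \<and>
     (\<forall>a\<ge>P + k. s a = 0) \<and> C = {l. \<exists>p<k. s (P + p) = code l})"
  proof (rule wp_mono)
    fix t s
    assume *: "t \<le> (s0(11 := P, 12 := n)) 12 * (20 + 1) + 1 \<and> I s \<and> s 12 = 0"
    \<comment> \<open>At most \<open>k\<close> literals are found, so the next free cell is at most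
      \<open>P + k\<close> and the later blocks stay fresh.\<close>
    have zero: "\<forall>a\<ge>P + k. s a = 0"
      using * D_le[of 0] unfolding I_def by fastforce
    have "C = D 0"
      by (simp add: D_def)
    also have "D 0 = {l. \<exists>a\<ge>P. s a = code l}"
      using * unfolding I_def by metis
    also have "\<dots> = {l. \<exists>p<k. s (P + p) = code l}"
    proof (intro Collect_cong iffI)
      fix l
      assume "\<exists>a\<ge>P. s a = code l"
      then obtain a where a: "P \<le> a" "s a = code l"
        by blast
      then have "a < P + k"
        using zero code_pos[of l] by (metis less_irrefl linorder_not_le)
      then show "\<exists>p<k. s (P + p) = code l"
        using a by (intro exI[of _ "a - P"]) auto
    qed (use le_add1 in blast)
    finally have C_eq: "C = {l. \<exists>p<k. s (P + p) = code l}" .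
    have "t + 3 \<le> 30 * (n + 1)"
      using * by simp
    then show "t + 3 \<le> 30 * (n + 1) \<and>
     (\<forall>a<P. a \<notin> {11..17} \<union> {20 + k..<21 + k + n + m} \<longrightarrow> s a = s0 a) \<and>
     (\<forall>a\<ge>P + k. s a = 0) \<and> C = {l. \<exists>p<k. s (P + p) = code l}"
      using * zero C_eq unfolding I_def by blast
  qed
  then show ?thesis
    using static unfolding probe_all_def by (simp add: static_def P_def C_def)
qed


section \<open>Filling the output table clause by clause\<close>

definition progress :: "nat \<Rightarrow> memory \<Rightarrow> bool" where
  "progress j s \<longleftrightarrow> static s \<and> j \<le> m \<and> s 8 = m - j \<and> s 9 = 21 + k + n + j \<and>
     s 10 = 21 + k + n + m + j * k \<and> (\<forall>a\<ge>21 + k + n + m + j * k. s a = 0) \<and>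
     (\<forall>i<j. \<phi> ! i = {l. \<exists>p<k. s (21 + k + n + m + i * k + p) = code l})"

text \<open>After clearing, the search cannot fail, because selecting some set of at most
  \<open>k\<close> variables violates the clause; probing then fills block \<open>j\<close>.\<close>

lemma wp_learn_clause:
  assumes "progress j s" "j < m"
  shows "wpr (learn_clause k) s (\<lambda>t s'. t \<le> (search_const k + 60) * (n + 1) ^ k \<and>
    progress (Suc j) s')"
proof -
  define P where "P = 21 + k + n + m + j * k"
  have st: "static s" and regs: "s 8 = m - j" "s 9 = 21 + k + n + j" "s 10 = P"
    and fresh: "\<And>a. P \<le> a \<Longrightarrow> s a = 0"
    and table: "\<And>i. i < j \<Longrightarrow> \<phi> ! i = {l. \<exists>p<k. s (21 + k + n + m + i * k + p) = code l}"
    using assms unfolding progress_def P_def by blast+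
  \<comment> \<open>The blocks of earlier clauses lie between the answer cells and \<open>P\<close>,
    where the treatment of clause \<open>j\<close> changes nothing.\<close>
  have row: "21 + k + n + m + i * k + p < P" if "i < j" "p < k" for i p
  proof -
    have "i * k + p < Suc i * k"
      using that by simp
    also have "\<dots> \<le> j * k"
      using that by (intro mult_le_mono1) simp
    finally show ?thesis
      by (simp add: P_def)
  qed
  have P: "21 + k + n + m \<le> P"
    by (simp add: P_def)
  define W where "W = {11..18} \<union> {20..<21 + k + n + m}"
  define finish where "finish = block [Add 9 9 2, Add 10 10 7, Sub 8 8 2]"
  define N where "N = (n + 1) ^ k"
  \<comment> \<open>Clearing and probing take time linear in \<open>n\<close>, which
    \<open>(n + 1) ^ k\<close> absorbs because \<open>k\<close> is positive.\<close>
  have n_le: "n + 1 \<le> N"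
    unfolding N_def using k_pos by (intro self_le_power) auto
  have fin: "wpr finish s4 (\<lambda>t s'. t \<le> 4 \<and> progress (Suc j) s')"
    if s4: "\<And>a. a < P \<Longrightarrow> a \<notin> W \<Longrightarrow> s4 a = s a"
      and fresh4: "\<forall>a\<ge>P + k. s4 a = 0" and row4: "\<phi> ! j = {l. \<exists>p<k. s4 (P + p) = code l}" for s4
  proof -
    have st4: "static s4"
      using P by (intro static_cong[OF st] s4) (auto simp: W_def)
    have regs4: "s4 8 = m - j" "s4 9 = 21 + k + n + j" "s4 10 = P"
      using P regs by (simp_all add: s4 W_def)
    define s5 where "s5 = s4(9 := Suc (21 + k + n + j), 10 := P + k, 8 := m - j - 1)"
    have high: "s5 a = s4 a" if "20 \<le> a" for a
      using that by (simp add: s5_def)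
    have "static s5"
      by (rule static_cong[OF st4]) (simp add: s5_def)
    moreover have "\<phi> ! i = {l. \<exists>p<k. s5 (21 + k + n + m + i * k + p) = code l}" if "i < Suc j" for i
    proof (cases "i = j")
      case True
      then show ?thesis
        using row4 by (simp add: high P_def)
    next
      case False
      then have "i < j"
        using that by simp
      then have "s5 (21 + k + n + m + i * k + p) = s (21 + k + n + m + i * k + p)" if "p < k" for p
        using row[OF \<open>i < j\<close> that] by (simp add: high s4 W_def)
      then show ?thesis
        using table[OF \<open>i < j\<close>] by (simp cong: conj_cong)
    qed
    moreover have "s5 a = 0" if "21 + k + n + m + Suc j * k \<le> a" for a
      using that fresh4 by (simp add: high P_def)
    ultimately have "progress (Suc j) s5"
      using assms(2) unfolding progress_def by (simp add: s5_def P_def)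
    then show ?thesis
      using st4 regs4 by (simp add: finish_def static_def s5_def)
  qed
  have probe: "wpr (Seq probe_all finish) s3 (\<lambda>t s'. t \<le> 30 * (n + 1) + 4 \<and> progress (Suc j) s')"
    if s3: "\<And>a. a \<notin> W \<Longrightarrow> s3 a = s a" and "falsifies (selected s3) j" for s3
  proof (rule wp_Seq_bounded)
    have "static s3"
      by (rule static_cong[OF st]) (simp add: s3 W_def)
    moreover have "s3 9 = 21 + k + n + j" "s3 10 = P"
      using regs by (simp_all add: s3 W_def)
    moreover have "s3 a = 0" if "P \<le> a" for a
      using that P by (simp add: s3 W_def fresh)
    ultimately show "wpr probe_all s3 (\<lambda>t s. t \<le> 30 * (n + 1) \<and>
     (\<forall>a<P. a \<notin> {11..17} \<union> {20 + k..<21 + k + n + m} \<longrightarrow> s a = s3 a) \<and>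
     (\<forall>a\<ge>P + k. s a = 0) \<and> \<phi> ! j = {l. \<exists>p<k. s (P + p) = code l})"
      using wp_probe_all[of s3 j] that(2) \<open>j < m\<close> P by simp
  qed (intro fin, auto simp: W_def s3)
  have search: "wpr (Seq (search k) (Seq probe_all finish)) s2
      (\<lambda>t s'. t \<le> search_const k * (n + 1) ^ k + (30 * (n + 1) + 4) \<and> progress (Suc j) s')"
    if s2: "\<And>a. a \<notin> W \<Longrightarrow> s2 a = s a" "s2 18 = 1" "selected s2 = {}" for s2
  proof (rule wp_Seq_bounded)
    have "static s2"
      by (rule static_cong[OF st]) (simp add: s2 W_def)
    then show "wpr (search k) s2 (\<lambda>t s'. t \<le> search_const k * (n + 1) ^ k \<and>
        search_frame k s2 s' \<and> search_result j (small_sets k) s2 s')"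
      using regs \<open>j < m\<close> by (intro wp_search) (simp_all add: s2 W_def)
  next
    fix s'
    assume *: "search_frame k s2 s' \<and> search_result j (small_sets k) s2 s'"
    have C: "is_clause n (\<phi> ! j)" "card (\<phi> ! j) \<le> k"
      using inst len \<open>j < m\<close> nth_mem[of j \<phi>] by (auto simp: kSAT_instance_def)
    \<comment> \<open>This set is among those tried from the empty selection, so failure of the
      search is contradictory.\<close>
    then have "{i. Neg i \<in> \<phi> ! j} \<in> small_sets k"
      using negated_variables_bounded[OF C(1)] by (simp add: small_sets_def)
    moreover have "falsifies {i. Neg i \<in> \<phi> ! j} j"
      using violated_by_negated_variables[OF C(1)] by (simp add: falsifies_def)
    ultimately have "falsifies (selected s') j"
      using * s2(3) by (auto simp: search_result_def)
    moreover have "s' a = s a" if "a \<notin> W" for a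
      using * that s2(1)[OF that] by (auto simp: search_frame_def W_def)
    ultimately show "wpr (Seq probe_all finish) s'
        (\<lambda>t s'. t \<le> 30 * (n + 1) + 4 \<and> progress (Suc j) s')"
      using probe by blast
  qed
  have "wpr (Seq clear (Seq (Const 18 1) (Seq (search k) (Seq probe_all finish)))) s
      (\<lambda>t s'. t \<le> 10 * (n + 1) + (1 + (search_const k * (n + 1) ^ k + (30 * (n + 1) + 4))) \<and>
        progress (Suc j) s')"
    using wp_clear[OF st]
  proof (rule wp_Seq_bounded)
    fix s1
    assume *: "(\<forall>a. a \<notin> {12, 13} \<union> {20 + k..<21 + k + n} \<longrightarrow> s1 a = s a) \<and> selected s1 = {}"
    show "wpr (Seq (Const 18 1) (Seq (search k) (Seq probe_all finish))) s1
      (\<lambda>t s'. t \<le> 1 + (search_const k * (n + 1) ^ k + (30 * (n + 1) + 4)) \<and> progress (Suc j) s')"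
    proof (rule wp_Seq_bounded)
      show "wpr (Const 18 1) s1 (\<lambda>t s'. t \<le> 1 \<and> s' = s1(18 := 1))"
        by simp
    next
      fix s'
      assume "s' = s1(18 := 1)"
      with * show "wpr (Seq (search k) (Seq probe_all finish)) s'
          (\<lambda>t s'. t \<le> search_const k * (n + 1) ^ k + (30 * (n + 1) + 4) \<and> progress (Suc j) s')"
        by (intro search) (auto simp: W_def selected_def)
    qed
  qed
  moreover have "10 * (n + 1) + (1 + (search_const k * N + (30 * (n + 1) + 4))) \<le> (search_const k + 60) * N"
    using n_le by (simp add: algebra_simps)
  ultimately have "wpr (Seq clear (Seq (Const 18 1) (Seq (search k) (Seq probe_all finish)))) s
      (\<lambda>t s'. t \<le> (search_const k + 60) * (n + 1) ^ k \<and> progress (Suc j) s')"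
    unfolding N_def by (elim wp_mono conjE) (intro conjI, rule order_trans)
  then show ?thesis
    unfolding learn_clause_def finish_def by simp
qed

lemma wp_learn:
  "wpr (learn k) (initial_memory n m)
     (\<lambda>t s. t \<le> m * ((search_const k + 60) * (n + 1) ^ k + 1) + 20 \<and> outputs_instance k \<phi> s)"
proof -
  define B where "B = (search_const k + 60) * (n + 1) ^ k"
  define s0 where "s0 = (initial_memory n m)(2 := 1, 4 := 20 + k, 6 := n + 1,
     5 := 20 + k + (n + 1), 7 := k, 8 := m, 9 := 20 + k + (n + 1), 10 := 20 + k + (n + 1) + m)"
  \<comment> \<open>Hiding \<open>j\<close> loses nothing: register 8 holds \<open>m - j\<close>
    with \<open>j \<le> m\<close>, so \<open>j = m\<close> on exit.\<close>
  define I where "I s \<longleftrightarrow> (\<exists>j. progress j s)" for s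
  have "wpr (learn_clause k) s (\<lambda>t s'. t \<le> B \<and> I s' \<and> s' 8 < s 8)" if I: "I s" and nz: "s 8 \<noteq> 0" for s
  proof -
    obtain j where j: "progress j s"
      using I unfolding I_def by blast
    then have "j < m"
      using nz by (simp add: progress_def)
    from wp_learn_clause[OF j this] show ?thesis
      by (rule wp_mono) (use j \<open>j < m\<close> in \<open>auto simp: B_def I_def progress_def\<close>)
  qed
  moreover have "progress 0 s0"
    by (simp add: progress_def static_def s0_def initial_memory_def)
  then have "I s0"
    unfolding I_def by blast
  ultimately have "wpr (WhileNZ 8 (learn_clause k)) s0 (\<lambda>t s. t \<le> s0 8 * (B + 1) + 1 \<and> I s \<and> s 8 = 0)"
    by (rule wp_WhileNZ)
  then have "wpr (WhileNZ 8 (learn_clause k)) s0 (\<lambda>t s. t \<le> m * (B + 1) + 1 \<and>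
     s 1 = m \<and> s 5 = 21 + k + n \<and> outputs_instance k \<phi> (s(0 := 0, 1 := 21 + k + n + m)))"
  proof (rule wp_mono)
    fix t s
    assume *: "t \<le> s0 8 * (B + 1) + 1 \<and> I s \<and> s 8 = 0"
    then obtain j where j: "progress j s"
      unfolding I_def by blast
    have "j = m"
      using * j by (auto simp: progress_def)
    with j have "progress m s"
      by simp
    then show "t \<le> m * (B + 1) + 1 \<and> s 1 = m \<and> s 5 = 21 + k + n \<and>
        outputs_instance k \<phi> (s(0 := 0, 1 := 21 + k + n + m))"
      using * by (simp add: progress_def static_def outputs_instance_def len s0_def)
  qed
  then show ?thesis
    unfolding learn_def B_def[symmetric] s0_def
    by (simp add: initial_memory_def) (erule wp_mono, auto)
qed

end

theorem theorem1:
  fixes k :: nat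
  assumes "k \<ge> 1"
  shows "\<exists>(A :: program) (K :: nat). \<forall>(n :: nat) (m :: nat) (\<phi> :: formula).
    kSAT_instance k n \<phi> \<and> length \<phi> = m \<longrightarrow>
    (\<exists>t s. exec n m (violated \<phi>) A (initial_memory n m) t s \<and>
           t \<le> K * (max 1 m * (max 1 n) ^ k) \<and>
           (outputs_instance k \<phi> s \<or> outputs_satisfying_assignment n \<phi> s))"
\<comment> \<open>The factor \<open>2 ^ k\<close> comes from \<open>n + 1 \<le> 2 * max 1 n\<close>;
  in \<open>21\<close>, one unit is the loop test per clause and 20 bound the work outside the loop
  body.\<close>
proof (rule exI[of _ "learn k"], rule exI[of _ "(search_const k + 60) * 2 ^ k + 21"],
    intro allI impI)
  fix n m :: nat and \<phi> :: formula
  assume "kSAT_instance k n \<phi> \<and> length \<phi> = m"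
  then interpret hidden_instance k n m \<phi>
    using assms by unfold_locales auto
  obtain t s where ts: "exec n m (violated \<phi>) (learn k) (initial_memory n m) t s"
      "t \<le> m * ((search_const k + 60) * (n + 1) ^ k + 1) + 20" "outputs_instance k \<phi> s"
    using wp_learn unfolding wp_def by blast
  define M N where "M = max 1 m" and "N = max 1 n ^ k"
  have "(n + 1) ^ k \<le> (2 * max 1 n) ^ k"
    by (intro power_mono) auto
  then have pow: "(n + 1) ^ k \<le> 2 ^ k * N"
    by (simp add: N_def power_mult_distrib)
  have pos: "1 \<le> M" "1 \<le> N" "m \<le> M"
    by (simp_all add: M_def N_def)
  have "m * ((search_const k + 60) * (n + 1) ^ k + 1) \<le> M * ((search_const k + 60) * (2 ^ k * N) + N)"
    using pow pos by (intro mult_le_mono add_mono) auto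
  moreover have "20 \<le> 20 * (M * N)"
    using pos mult_le_mono[of 1 M 1 N] by simp
  moreover have "M * ((search_const k + 60) * (2 ^ k * N) + N) + 20 * (M * N) =
      ((search_const k + 60) * 2 ^ k + 21) * (M * N)"
    by (simp add: algebra_simps)
  ultimately have "t \<le> ((search_const k + 60) * 2 ^ k + 21) * (M * N)"
    using ts(2) by linarith
  then show "\<exists>t s. exec n m (violated \<phi>) (learn k) (initial_memory n m) t s \<and>
           t \<le> ((search_const k + 60) * 2 ^ k + 21) * (max 1 m * (max 1 n) ^ k) \<and>
           (outputs_instance k \<phi> s \<or> outputs_satisfying_assignment n \<phi> s)"
    using ts by (auto simp: M_def N_def)
qed

end
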